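(* For each integer $m>1$ let $\zeta_m=\frac{1}{\ln p_m}\sum_{j=1}^m \nu_j\ln p_j$, regarded as a random variable on the probability space $(\Omega_m,\Pi_m)$. As $m\to\infty$ the distributions of $\zeta_m$ converge weakly to the infinitely divisible probability distribution on $\mathbb{R}$ whose characteristic function $\varphi(\lambda)$, $\lambda\in\mathbb{R}$, has the form $$\varphi(\lambda)=\exp\left\{\int_0^1\frac{e^{i\lambda v}-1}{v}\,\mathrm{d}v\right\}.$$
   Context: Let $p_1<p_2<p_3<\ldots$ be the sequence of all prime numbers in increasing order. For an integer $m>1$ let $\Omega_m$ be the finite set of all integers of the form $n=\prod_{j=1}^m p_j^{\nu_j}$ with $\nu_j\in\{0,1\}$; the exponents $\nu_j=\nu_j(n)$ are viewed as functions on $\Omega_m$. Let $\Pi_m$ be the probability distribution on $\Omega_m$ that assigns to $n\in\Omega_m$ the probability $\pi_m(n)=\frac{1}{Z_m}\frac1n$, where $Z_m=\sum_{n\in\Omega_m}\frac1n=\prod_{j=1}^m\left(1+\frac{1}{p_j}\right)$. *)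

theory Defs
  imports
    "HOL-Probability.Probability"
    "HOL-Computational_Algebra.Primes"
    "HOL-Library.Infinite_Set"
begin

text \<open>The primes are counted from 1, so \<open>nth_prime 1 = 2\<close>; \<open>enumerate\<close> counts from 0.
  The value at index 0 is irrelevant.\<close>

definition nth_prime :: "nat \<Rightarrow> nat" where
  "nth_prime j = enumerate {p. prime p} (j - 1)"

definition Omega_set :: "nat \<Rightarrow> nat set" where
  "Omega_set m = {n. \<exists>\<nu> :: nat \<Rightarrow> nat. (\<forall>j\<in>{1..m}. \<nu> j \<in> {0, 1}) \<and>
     n = (\<Prod>j=1..m. nth_prime j ^ \<nu> j)}"

text \<open>By unique factorization the exponent of \<open>nth_prime j\<close> in \<open>n\<close> is its multiplicity.\<close>

definition nu :: "nat \<Rightarrow> nat \<Rightarrow> nat" where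
  "nu j n = multiplicity (nth_prime j) n"

definition Z_norm :: "nat \<Rightarrow> real" where
  "Z_norm m = (\<Sum>n\<in>Omega_set m. 1 / real n)"

definition Pi_distr :: "nat \<Rightarrow> nat measure" where
  "Pi_distr m = point_measure (Omega_set m) (\<lambda>n. ennreal (1 / Z_norm m * (1 / real n)))"

definition zeta :: "nat \<Rightarrow> nat \<Rightarrow> real" where
  "zeta m n = 1 / ln (real (nth_prime m)) *
     (\<Sum>j=1..m. real (nu j n) * ln (real (nth_prime j)))"

primrec convolution_power :: "real measure \<Rightarrow> nat \<Rightarrow> real measure" where
  "convolution_power N 0 = return borel 0"
| "convolution_power N (Suc k) = convolution N (convolution_power N k)"

definition infinitely_divisible :: "real measure \<Rightarrow> bool" where
  "infinitely_divisible M \<longleftrightarrow> real_distribution M \<and>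
     (\<forall>k\<ge>1. \<exists>N. real_distribution N \<and> M = convolution_power N k)"

end

theory Submission
  imports Defs
begin

text \<open>
  Writing \<open>v\<^sub>j = ln p\<^sub>j / ln p\<^sub>m\<close>, the random variable \<open>\<zeta>\<^sub>m\<close> is a sum of independent variables that take
  the value \<open>v\<^sub>j\<close> with probability \<open>q\<^sub>j = 1 / (p\<^sub>j + 1)\<close> and vanish otherwise, so its characteristic
  function is the product of the factors \<open>1 + q\<^sub>j (exp (i t v\<^sub>j) - 1)\<close>. By Mertens' first theorem the
  point masses \<open>q\<^sub>j v\<^sub>j\<close> at \<open>v\<^sub>j\<close> converge weakly to the uniform distribution on \<open>[0,1]\<close>; integrating
  \<open>(exp (i t v) - 1) / v\<close> against them gives the limit of the sum of the \<open>q\<^sub>j (exp (i t v\<^sub>j) - 1)\<close>,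
  and the logarithm of the product differs from this sum by a null sequence. The same computation
  with probabilities \<open>\<theta> q\<^sub>j\<close> for \<open>0 \<le> \<theta> \<le> 1\<close>, together with tightness (the means are bounded),
  produces a distribution whose characteristic function is the \<open>\<theta>\<close>-th power of the limit:
  \<open>\<theta> = 1\<close> gives the limit distribution itself and \<open>\<theta> = 1 / k\<close> its \<open>k\<close>-th convolution root.
\<close>

section \<open>Mertens' first theorem\<close>

lemma multiplicity_eq_sum_dvd:
  fixes p k N :: nat
  assumes "prime p" "0 < k" "k \<le> N"
  shows "multiplicity p k = (\<Sum>i=1..N. if p ^ i dvd k then 1 else 0)"
proof -
  \<comment> \<open>An exponent is smaller than its power of \<open>p\<close>, and that power is at
    most \<open>k\<close>. So cutting the sum at \<open>N\<close> loses no exponent.\<close>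
  have "multiplicity p k < p ^ multiplicity p k"
    using prime_gt_1_nat[OF assms(1)] power_gt_expt[of p "multiplicity p k"] by linarith
  also have "\<dots> \<le> k"
    using assms(2) multiplicity_dvd[of p k] by (rule dvd_imp_le[rotated])
  finally have le: "multiplicity p k \<le> N"
    using assms by linarith
  have "p ^ i dvd k \<longleftrightarrow> i \<le> multiplicity p k" for i
    by (rule power_dvd_iff_le_multiplicity) (use assms not_prime_unit in auto)
  then have "{i\<in>{1..N}. p ^ i dvd k} = {i\<in>{1..N}. i \<le> multiplicity p k}"
    by presburger
  also have "\<dots> = {1..multiplicity p k}"
    using le by auto
  finally have "{i\<in>{1..N}. p ^ i dvd k} = {1..multiplicity p k}" .
  then have "multiplicity p k = card {i\<in>{1..N}. p ^ i dvd k}"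
    by simp
  also have "\<dots> = (\<Sum>i\<in>{i\<in>{1..N}. p ^ i dvd k}. 1)"
    by (rule card_eq_sum)
  also have "\<dots> = (\<Sum>i=1..N. if p ^ i dvd k then 1 else 0)"
    by (rule sum.inter_filter) simp
  finally show ?thesis .
qed

text \<open>Legendre's formula: passing to \<open>Suc n\<close> raises \<open>n div p ^ i\<close> by
  one exactly when \<open>p ^ i\<close> divides \<open>Suc n\<close>. The cutoff \<open>N\<close> is
  separate from \<open>n\<close> so that the range of summation stays fixed during the
  induction.\<close>

lemma multiplicity_fact_nat:
  fixes p n N :: nat
  assumes p: "prime p" and "n \<le> N"
  shows "multiplicity p (fact n :: nat) = (\<Sum>i=1..N. n div p ^ i)"
  using assms(2)
proof (induction n)
  case (Suc n)
  have "multiplicity p (fact (Suc n) :: nat) = multiplicity p (Suc n) + multiplicity p (fact n :: nat)"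
    unfolding fact_Suc using p
    by (subst prime_elem_multiplicity_mult_distrib) (auto simp: prime_imp_prime_elem)
  also have "\<dots> = (\<Sum>i=1..N. (if p ^ i dvd Suc n then 1 else 0) + n div p ^ i)"
    using Suc p by (simp add: multiplicity_eq_sum_dvd[of p "Suc n" N] sum.distrib)
  also have "\<dots> = (\<Sum>i=1..N. Suc n div p ^ i)"
    by (intro sum.cong refl) (auto simp: div_Suc mod_eq_0_iff_dvd)
  finally show ?case .
qed simp

lemma ln_fact_eq_sum_primes:
  "ln (fact n :: real) = (\<Sum>p | prime p \<and> p \<le> n. real (multiplicity p (fact n :: nat)) * ln (real p))"
proof -
  have eq: "prime_factors (fact n :: nat) = {p. prime p \<and> p \<le> n}"
    by (auto simp: prime_factors_dvd prime_dvd_fact_iff)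
  have "real (fact n) = (\<Prod>p | prime p \<and> p \<le> n. real p ^ multiplicity p (fact n :: nat))"
    using arg_cong[OF prod_prime_factors[of "fact n :: nat"], of real]
    unfolding eq normalize_nat_def id_apply of_nat_prod of_nat_power by simp
  then have "ln (fact n :: real) = ln (\<Prod>p | prime p \<and> p \<le> n. real p ^ multiplicity p (fact n :: nat))"
    unfolding of_nat_fact by (rule arg_cong)
  also have "\<dots> = (\<Sum>p | prime p \<and> p \<le> n. ln (real p ^ multiplicity p (fact n :: nat)))"
    by (intro ln_prod) (auto simp: prime_gt_0_nat)
  also have "\<dots> = (\<Sum>p | prime p \<and> p \<le> n. real (multiplicity p (fact n :: nat)) * ln (real p))"
    by (intro sum.cong refl) (auto simp: ln_realpow prime_gt_0_nat)
  finally show ?thesis .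
qed

lemma multiplicity_fact_ge: "prime p \<Longrightarrow> p \<le> n \<Longrightarrow> n div p \<le> multiplicity p (fact n :: nat)"
  for p n :: nat
proof -
  assume p: "prime p" "p \<le> n"
  then have "n \<ge> 1" using prime_gt_0_nat[of p] by linarith
  then have "n div p ^ 1 \<le> (\<Sum>i=1..n. n div p ^ i)"
    by (intro member_le_sum) auto
  then show ?thesis
    using p by (simp add: multiplicity_fact_nat[of p n n])
qed

text \<open>Dropping the floors in Legendre's formula leaves a geometric series.\<close>

lemma multiplicity_fact_le:
  fixes p n :: nat
  assumes "prime p"
  shows "real (multiplicity p (fact n :: nat)) \<le> real n / (real p - 1)"
proof -
  have p: "real p > 1" using prime_gt_1_nat[OF assms] by simp
  have geo: "(\<Sum>i=1..N. 1 / real p ^ i) = (1 - 1 / real p ^ N) / (real p - 1)" for N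
  proof (induction N)
    case (Suc N)
    have "(1 - 1 / real p ^ N) / (real p - 1) + 1 / real p ^ Suc N = (1 - 1 / real p ^ Suc N) / (real p - 1)"
      using p by (simp add: field_simps)
    with Suc show ?case by simp
  qed simp
  have "real (multiplicity p (fact n :: nat)) = (\<Sum>i=1..n. real (n div p ^ i))"
    by (simp add: multiplicity_fact_nat[OF assms order.refl])
  also have "\<dots> \<le> (\<Sum>i=1..n. real n * (1 / real p ^ i))"
    using of_nat_div_le_of_nat[of n "p ^ _", where 'a=real] by (intro sum_mono) simp
  also have "\<dots> = real n * ((1 - 1 / real p ^ n) / (real p - 1))"
    by (simp only: geo flip: sum_distrib_left)
  also have "\<dots> \<le> real n * (1 / (real p - 1))"
    using p by (intro mult_left_mono divide_right_mono) auto
  finally show ?thesis by simp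
qed

text \<open>A weak Stirling bound; the induction step amounts to
  \<open>n * (ln (n + 1) - ln n) \<le> 1\<close>.\<close>

lemma ln_fact_ge: "real n * ln (real n) - real n \<le> ln (fact n)"
proof (induction n)
  case (Suc n)
  show ?case
  proof (cases "n = 0")
    case False
    have "ln (1 + 1 / real n) \<le> 1 / real n"
      by (rule ln_add_one_self_le_self) simp
    moreover have "ln (1 + 1 / real n) = ln (real (Suc n)) - ln (real n)"
      using False ln_div[of "real (Suc n)" "real n"] by (simp add: field_simps)
    ultimately have "real n * (ln (real (Suc n)) - ln (real n)) \<le> real n * (1 / real n)"
      by (intro mult_left_mono) auto
    also have "\<dots> = 1" using False by simp
    finally have "real n * (ln (real (Suc n)) - ln (real n)) \<le> 1" .
    moreover have "ln (fact (Suc n) :: real) = ln (real (Suc n)) + ln (fact n)"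
      unfolding fact_Suc of_nat_mult by (subst ln_mult_pos) auto
    ultimately show ?thesis
      using Suc by (simp add: algebra_simps)
  qed simp
qed simp

lemma ln_fact_le: "ln (fact n :: real) \<le> real n * ln (real n)"
proof (cases "n = 0")
  case False
  have "(fact n :: real) \<le> real n ^ n"
    using fact_le_power[of n, where 'a=real] by simp
  then have "ln (fact n :: real) \<le> ln (real n ^ n)"
    using False by (subst ln_le_cancel_iff) auto
  then show ?thesis
    using False by (simp add: ln_realpow)
qed simp

section \<open>Chebyshev's upper bound for the primes\<close>

lemma prod_primes_dvd:
  fixes m :: nat
  assumes "finite A" "\<And>p. p \<in> A \<Longrightarrow> prime p" "\<And>p. p \<in> A \<Longrightarrow> p dvd m"
  shows "\<Prod>A dvd m"
  using assms
proof (induction A)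
  case (insert p A)
  have "coprime p (\<Prod>A)"
    using insert by (intro prod_coprime_right) (auto intro!: primes_coprime)
  then show ?case
    using insert by (simp add: divides_mult)
qed simp

text \<open>The two middle coefficients of this row are equal, and the whole row sums to
  \<open>2 * 4 ^ m\<close>.\<close>

lemma odd_binomial_le: "Suc (2 * m) choose m \<le> 4 ^ m"
proof -
  have "(Suc (2 * m) choose m) + (Suc (2 * m) choose Suc m) = (\<Sum>k\<in>{m, Suc m}. Suc (2 * m) choose k)"
    by simp
  also have "\<dots> \<le> (\<Sum>k\<le>Suc (2 * m). Suc (2 * m) choose k)"
    by (intro sum_mono2) auto
  also have "\<dots> = 2 * 4 ^ m"
    unfolding choose_row_sum by (simp add: power_mult)
  finally show ?thesis
    using binomial_symmetric[of m "Suc (2 * m)"] by simp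
qed

text \<open>Erdos's argument. An even \<open>n > 2\<close> is not prime, so it reduces to
  \<open>n - 1\<close>. For \<open>n = 2 * m + 1\<close> the primes up to \<open>m + 1\<close> are
  covered by induction, and the remaining ones all divide \<open>n choose m\<close>, which is at
  most \<open>4 ^ m\<close>.\<close>

lemma primorial_le: "\<Prod>{p. prime p \<and> p \<le> n} \<le> (4 :: nat) ^ n"
proof (induction n rule: less_induct)
  case (less n)
  consider "n = 0" | "n = 1" | "n = 2" | m where "n = 2 * m" "m > 1" | m where "n = Suc (2 * m)" "m \<ge> 1"
  proof (cases "even n")
    case True
    then obtain m where "n = 2 * m" by auto
    then show ?thesis using that by (cases "m > 1") (auto simp: le_Suc_eq not_less)
  next
    case False
    then obtain m where "n = 2 * m + 1" by (auto elim: oddE)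
    then show ?thesis using that by (cases "m \<ge> 1") auto
  qed
  then show ?case
  proof cases
    case 1
    then have eq: "{p. prime p \<and> p \<le> n} = {}" by auto
    show ?thesis unfolding eq by simp
  next
    case 2
    then have eq: "{p. prime p \<and> p \<le> n} = {}" by (auto dest: prime_gt_1_nat)
    show ?thesis unfolding eq by simp
  next
    case 3
    have "p = 2" if "prime p" "p \<le> 2" for p :: nat
      using prime_ge_2_nat[OF that(1)] that(2) by simp
    with 3 have eq: "{p. prime p \<and> p \<le> n} = {2}" by auto
    show ?thesis unfolding eq by (simp add: 3)
  next
    case (4 m)
    have "\<not> prime n"
      using 4 prime_product[of 2 m] by auto
    then have "{p. prime p \<and> p \<le> n} = {p. prime p \<and> p \<le> n - 1}"
      by (auto simp: le_eq_less_or_eq)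
    also have "\<Prod>\<dots> \<le> 4 ^ (n - 1)"
      using 4 by (intro less) auto
    also have "\<dots> \<le> 4 ^ n"
      by (intro power_increasing) auto
    finally show ?thesis .
  next
    case (5 m)
    let ?U = "{p. prime p \<and> m + 1 < p \<and> p \<le> n}"
    have "{p. prime p \<and> p \<le> n} = {p. prime p \<and> p \<le> m + 1} \<union> ?U"
      using 5 by auto
    then have "\<Prod>{p. prime p \<and> p \<le> n} = \<Prod>{p. prime p \<and> p \<le> m + 1} * \<Prod>?U"
      by (simp only:) (intro prod.union_disjoint; auto)
    also have "\<dots> \<le> 4 ^ (m + 1) * (n choose m)"
    proof (rule mult_le_mono)
      show "\<Prod>{p. prime p \<and> p \<le> m + 1} \<le> 4 ^ (m + 1)"
        using 5 by (intro less) auto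
      \<comment> \<open>A prime in \<open>?U\<close> divides \<open>fact n\<close> but, exceeding
        \<open>m + 1 = n - m\<close>, divides neither \<open>fact m\<close> nor
        \<open>fact (n - m)\<close>; so it divides the binomial coefficient.\<close>
      have "\<Prod>?U dvd (n choose m)"
      proof (rule prod_primes_dvd)
        fix p assume p: "p \<in> ?U"
        then have "p dvd fact n" by (auto simp: prime_dvd_fact_iff)
        then have "p dvd fact m * fact (n - m) * (n choose m)"
          using 5 by (subst binomial_fact_lemma) auto
        then show "p dvd (n choose m)"
          using p 5 by (auto simp: prime_dvd_mult_iff prime_dvd_fact_iff simp del: fact_Suc)
      qed auto
      then show "\<Prod>?U \<le> n choose m"
        by (rule dvd_imp_le) (use 5 in simp)
    qed
    also have "\<dots> \<le> 4 ^ (m + 1) * 4 ^ m"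
      unfolding 5 by (intro mult_le_mono odd_binomial_le) simp
    also have "\<dots> = 4 ^ n"
      unfolding 5 power_add[symmetric] by (simp add: mult_2)
    finally show ?thesis .
  qed
qed

text \<open>Chebyshev's bound for the theta function, obtained by taking logarithms of the primorial
  bound.\<close>

lemma sum_ln_primes_le: "(\<Sum>p | prime p \<and> p \<le> n. ln (real p)) \<le> real n * ln 4"
proof -
  have "(\<Sum>p | prime p \<and> p \<le> n. ln (real p)) = ln (\<Prod>p | prime p \<and> p \<le> n. real p)"
    by (intro ln_prod[symmetric]) (auto simp: prime_gt_0_nat)
  also have "(\<Prod>p | prime p \<and> p \<le> n. real p) = real (\<Prod>{p. prime p \<and> p \<le> n})"
    by simp
  also have "ln \<dots> \<le> ln (real (4 ^ n))"
    using primorial_le[of n]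
    by (subst ln_le_cancel_iff) (auto simp del: of_nat_prod of_nat_power simp: prod_pos prime_gt_0_nat)
  finally show ?thesis by (simp add: ln_realpow)
qed

text \<open>The denominator is \<open>p + 1\<close> rather than \<open>p\<close> because a prime divides a random element of
  \<open>Omega_set m\<close> with probability \<open>1 / (p + 1)\<close>.\<close>

definition mertens_sum :: "real \<Rightarrow> real" where
  "mertens_sum x = (\<Sum>p | prime p \<and> real p \<le> x. ln (real p) / (real p + 1))"

section \<open>Two-sided bounds for the Mertens sum\<close>

lemma mertens_sum_of_nat: "mertens_sum (real n) = (\<Sum>p | prime p \<and> p \<le> n. ln (real p) / (real p + 1))"
  by (simp add: mertens_sum_def)

lemma mertens_sum_floor: "x \<ge> 0 \<Longrightarrow> mertens_sum x = mertens_sum (real (nat \<lfloor>x\<rfloor>))"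
  unfolding mertens_sum_def
proof (intro arg_cong2[where f=sum] Collect_cong conj_cong refl)
  fix p assume "x \<ge> 0"
  then show "real p \<le> x \<longleftrightarrow> real p \<le> real (nat \<lfloor>x\<rfloor>)"
    using le_floor_iff[of "int p" x] by (simp del: le_floor_iff) linarith
qed

text \<open>The multiplicity of \<open>p\<close> in \<open>fact n\<close> is at least
  \<open>n / p - 1\<close>, so \<open>n\<close> times the sum is at most \<open>ln (fact n)\<close>
  plus the theta function. Chebyshev's bound makes the latter linear in \<open>n\<close>.\<close>

lemma mertens_sum_le:
  assumes "n > 0"
  shows "mertens_sum (real n) \<le> ln (real n) + ln 4"
proof -
  let ?P = "{p. prime p \<and> p \<le> n}"
  have "real n * mertens_sum (real n) \<le> (\<Sum>p\<in>?P. real n / real p * ln (real p))"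
    unfolding mertens_sum_of_nat sum_distrib_left
  proof (rule sum_mono)
    fix p assume "p \<in> ?P"
    then have "real p > 1" using prime_gt_1_nat[of p] by auto
    then show "real n * (ln (real p) / (real p + 1)) \<le> real n / real p * ln (real p)"
      by (simp add: field_simps mult_left_mono)
  qed
  also have "\<dots> \<le> (\<Sum>p\<in>?P. (real (multiplicity p (fact n :: nat)) + 1) * ln (real p))"
  proof (intro sum_mono mult_right_mono)
    fix p assume p: "p \<in> ?P"
    then have "real (n div p) \<le> real (multiplicity p (fact n :: nat))"
      using multiplicity_fact_ge[of p n] by simp
    moreover have "real n / real p \<le> real (n div p) + 1"
      using floor_divide_of_nat_eq[of n p, where 'a=real] by linarith
    ultimately show "real n / real p \<le> real (multiplicity p (fact n :: nat)) + 1" by simp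
    show "0 \<le> ln (real p)" using p prime_ge_1_nat[of p] by auto
  qed
  also have "\<dots> = ln (fact n) + (\<Sum>p\<in>?P. ln (real p))"
    by (simp add: ln_fact_eq_sum_primes algebra_simps sum.distrib)
  also have "\<dots> \<le> real n * (ln (real n) + ln 4)"
    using ln_fact_le[of n] sum_ln_primes_le[of n] by (simp add: algebra_simps)
  finally show ?thesis using assms by simp
qed

text \<open>The upper bound \<open>n / (p - 1)\<close> for multiplicities gives the estimate with
  denominators \<open>p - 1\<close>; changing these to \<open>p + 1\<close> costs no more than a
  convergent series.\<close>

lemma mertens_sum_ge: "\<exists>D. \<forall>n>0. ln (real n) - D \<le> mertens_sum (real n)"
proof -
  \<comment> \<open>The two quotients differ by \<open>2 * ln p / (p^2 - 1)\<close>. With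
    \<open>ln p \<le> 2 * sqrt p\<close> and \<open>p^2 - 1 \<ge> 3/4 * p^2\<close> for
    \<open>p \<ge> 2\<close> this is at most \<open>16/3 * p powr (-3/2)\<close>.\<close>
  define D where "D = (\<Sum>n. 16 / 3 * real n powr (-3/2))"
  have summ: "summable (\<lambda>n. 16 / 3 * real n powr (-3/2))"
    by (intro summable_mult) (simp add: summable_real_powr_iff)
  have "ln (real n) - (1 + D) \<le> mertens_sum (real n)" if n: "n > 0" for n
  proof -
    let ?P = "{p. prime p \<and> p \<le> n}"
    have "real n * (ln (real n) - 1) \<le> ln (fact n)"
      using ln_fact_ge[of n] by (simp add: algebra_simps)
    also have "\<dots> \<le> (\<Sum>p\<in>?P. real n / (real p - 1) * ln (real p))"
      unfolding ln_fact_eq_sum_primes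
      by (intro sum_mono mult_right_mono multiplicity_fact_le) (auto intro!: ln_ge_zero prime_ge_1_nat simp: Suc_le_eq prime_gt_0_nat)
    also have "\<dots> = real n * (\<Sum>p\<in>?P. ln (real p) / (real p - 1))"
      by (simp add: sum_distrib_left)
    finally have "ln (real n) - 1 \<le> (\<Sum>p\<in>?P. ln (real p) / (real p - 1))"
      using n by simp
    also have "\<dots> \<le> (\<Sum>p\<in>?P. ln (real p) / (real p + 1) + 16 / 3 * real p powr (-3/2))"
    proof (rule sum_mono)
      fix p assume "p \<in> ?P"
      then have p: "real p \<ge> 2" using prime_ge_2_nat[of p] by auto
      have "ln (real p) / (real p - 1) - ln (real p) / (real p + 1) = 2 * ln (real p) / ((real p)\<^sup>2 - 1)"
        using p by (simp add: field_simps power2_eq_square)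
      also have "\<dots> \<le> 2 * (2 * real p powr (1/2)) / (3 / 4 * (real p)\<^sup>2)"
      proof (rule frac_le)
        have "ln (real p powr (1/2)) \<le> real p powr (1/2)"
          using p ln_less_self[of "real p powr (1/2)"] by simp
        then show "2 * ln (real p) \<le> 2 * (2 * real p powr (1/2))"
          using p by (simp add: ln_powr)
        have "2 * 2 \<le> real p * real p" using p by (intro mult_mono) auto
        then show "3 / 4 * (real p)\<^sup>2 \<le> (real p)\<^sup>2 - 1" by (simp add: power2_eq_square)
      qed (use p in auto)
      also have "\<dots> = 16 / 3 * (real p powr (1/2) / real p powr 2)"
        using p by (simp add: powr_numeral)
      also have "real p powr (1/2) / real p powr 2 = real p powr (-3/2)"
        by (subst powr_diff[symmetric]) simp
      finally show "ln (real p) / (real p - 1) \<le> ln (real p) / (real p + 1) + 16 / 3 * real p powr (-3/2)"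
        by linarith
    qed
    also have "\<dots> = mertens_sum (real n) + (\<Sum>p\<in>?P. 16 / 3 * real p powr (-3/2))"
      by (simp add: sum.distrib mertens_sum_of_nat)
    also have "(\<Sum>p\<in>?P. 16 / 3 * real p powr (-3/2)) \<le> D"
      unfolding D_def by (intro sum_le_suminf summ) auto
    finally show ?thesis by simp
  qed
  then show ?thesis by blast
qed

text \<open>From integers to reals: the sum does not change between the floor of \<open>x\<close>
  and \<open>x\<close>, and \<open>ln\<close> grows by at most 1 there.\<close>

lemma mertens_first:
  "\<exists>C. \<forall>x\<ge>1. \<bar>mertens_sum x - ln x\<bar> \<le> C"
proof -
  obtain D where D: "\<And>n. n > 0 \<Longrightarrow> ln (real n) - D \<le> mertens_sum (real n)"
    using mertens_sum_ge by blast
  have "\<bar>mertens_sum x - ln x\<bar> \<le> max (ln 4) (D + 1)" if x: "x \<ge> 1" for x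
  proof -
    define n where "n = nat \<lfloor>x\<rfloor>"
    have n: "n > 0" "real n \<le> x" "x \<le> real n + 1"
      using x unfolding n_def by (simp_all add: le_floor_iff)
    have "ln (real n + 1) - ln (real n) = ln (1 + 1 / real n)"
      using n ln_div[of "real n + 1" "real n"] by (simp add: field_simps)
    also have "\<dots> \<le> 1 / real n"
      by (rule ln_add_one_self_le_self) simp
    also have "\<dots> \<le> 1" using n by simp
    finally have "ln x \<le> ln (real n) + 1"
      using n x ln_le_cancel_iff[of x "real n + 1"] by linarith
    moreover have "ln (real n) \<le> ln x" using n by simp
    moreover have "mertens_sum x = mertens_sum (real n)"
      unfolding n_def using x by (intro mertens_sum_floor) simp
    ultimately show ?thesis
      using D[OF n(1)] mertens_sum_le[OF n(1)] by linarith
  qed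
  then show ?thesis by blast
qed

lemma mertens_sum_asymp: "((\<lambda>x. mertens_sum x / ln x) \<longlongrightarrow> 1) at_top"
proof -
  obtain C where C: "\<And>x. x \<ge> 1 \<Longrightarrow> \<bar>mertens_sum x - ln x\<bar> \<le> C"
    using mertens_first by blast
  have lim: "((\<lambda>x::real. C / ln x) \<longlongrightarrow> 0) at_top"
    by (intro tendsto_divide_0[OF tendsto_const] filterlim_at_top_imp_at_infinity ln_at_top)
  have "((\<lambda>x. mertens_sum x / ln x - 1) \<longlongrightarrow> 0) at_top"
  proof (rule tendsto_0_le[OF lim, of _ 1])
    show "\<forall>\<^sub>F x in at_top. norm (mertens_sum x / ln x - 1) \<le> norm (C / ln x) * 1"
      using eventually_gt_at_top[of 1]
    proof eventually_elim
      case (elim x)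
      then have "mertens_sum x / ln x - 1 = (mertens_sum x - ln x) / ln x"
        by (simp add: field_simps)
      then show ?case
        using C[of x] elim by (auto simp: divide_right_mono)
    qed
  qed
  then show ?thesis by (simp add: LIM_zero_iff)
qed

section \<open>Equidistribution of the logarithms of primes\<close>

lemma prime_nth_prime: "prime (nth_prime j)"
  unfolding nth_prime_def using enumerate_in_set[OF primes_infinite, of "j - 1"] by simp

lemma nth_prime_gt_1: "real (nth_prime j) > 1"
  using prime_gt_1_nat[OF prime_nth_prime, of j] by simp

lemma ln_nth_prime_pos: "ln (real (nth_prime j)) > 0"
  by (rule ln_gt_zero[OF nth_prime_gt_1])

lemma nth_prime_le_iff: "1 \<le> i \<Longrightarrow> 1 \<le> j \<Longrightarrow> nth_prime i \<le> nth_prime j \<longleftrightarrow> i \<le> j"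
  unfolding nth_prime_def using primes_infinite by auto

lemma inj_on_nth_prime: "inj_on nth_prime {1..}"
proof (rule inj_onI)
  fix i j assume "i \<in> {1..}" "j \<in> {1..}" "nth_prime i = nth_prime j"
  then show "i = j"
    using nth_prime_le_iff[of i j] nth_prime_le_iff[of j i] by simp
qed

lemma bij_betw_nth_prime:
  assumes "1 \<le> m"
  shows "bij_betw nth_prime {1..m} {p. prime p \<and> p \<le> nth_prime m}"
proof (rule bij_betw_imageI)
  show "inj_on nth_prime {1..m}"
    by (rule inj_on_subset[OF inj_on_nth_prime]) auto
  show "nth_prime ` {1..m} = {p. prime p \<and> p \<le> nth_prime m}"
  proof (intro equalityI subsetI)
    fix p assume p: "p \<in> {p. prime p \<and> p \<le> nth_prime m}"
    then obtain k where "enumerate {p. prime p} k = p"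
      using enumerate_Ex[OF primes_infinite, of p] by auto
    \<comment> \<open>The shift reconciles \<open>enumerate\<close>, counting from 0, with
      \<open>nth_prime\<close>, counting from 1.\<close>
    then have "nth_prime (Suc k) = p"
      by (simp add: nth_prime_def)
    with p assms nth_prime_le_iff[of "Suc k" m] show "p \<in> nth_prime ` {1..m}"
      by (intro image_eqI[of _ _ "Suc k"]) auto
  next
    fix p assume "p \<in> nth_prime ` {1..m}"
    then show "p \<in> {p. prime p \<and> p \<le> nth_prime m}"
      using assms by (auto simp: prime_nth_prime nth_prime_le_iff)
  qed
qed

lemma filterlim_nth_prime: "filterlim (\<lambda>m. real (nth_prime m)) at_top sequentially"
proof (rule filterlim_compose[OF filterlim_real_sequentially])
  have "m \<le> nth_prime (Suc m)" for m
    unfolding nth_prime_def using le_enumerate[OF primes_infinite, of m] by simp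
  then have "filterlim (\<lambda>m. nth_prime (Suc m)) at_top sequentially"
    by (intro filterlim_at_top_mono[OF filterlim_ident] always_eventually) auto
  then show "filterlim nth_prime at_top sequentially"
    by (simp add: filterlim_sequentially_Suc)
qed

definition prime_pos :: "nat \<Rightarrow> nat \<Rightarrow> real" where
  "prime_pos m j = ln (real (nth_prime j)) / ln (real (nth_prime m))"

text \<open>The probability under \<open>Pi_distr m\<close> that the \<open>j\<close>-th prime
  \<open>p\<close> is selected: \<open>(1/p) / (1 + 1/p) = 1 / (p + 1)\<close>.\<close>

definition prime_prob :: "nat \<Rightarrow> real" where
  "prime_prob j = 1 / (real (nth_prime j) + 1)"

lemma prime_pos_pos: "prime_pos m j > 0"
  by (simp add: prime_pos_def ln_nth_prime_pos)

lemma prime_prob_pos: "prime_prob j > 0"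
  unfolding prime_prob_def by (simp add: add_pos_pos)

lemma prime_prob_le_1: "prime_prob j \<le> 1"
  unfolding prime_prob_def by simp

lemma prime_pos_le_1: "j \<in> {1..m} \<Longrightarrow> prime_pos m j \<le> 1"
  unfolding prime_pos_def using nth_prime_le_iff[of j m] ln_nth_prime_pos[of m] nth_prime_gt_1[of j]
  by (simp add: divide_le_eq_1)

lemma prime_pos_le_iff: "prime_pos m j \<le> s \<longleftrightarrow> real (nth_prime j) \<le> real (nth_prime m) powr s"
proof -
  have "prime_pos m j \<le> s \<longleftrightarrow> ln (real (nth_prime j)) \<le> s * ln (real (nth_prime m))"
    using ln_nth_prime_pos[of m] by (simp add: prime_pos_def pos_divide_le_eq)
  also have "s * ln (real (nth_prime m)) = ln (real (nth_prime m) powr s)"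
    using nth_prime_gt_1[of m] by (simp add: ln_powr)
  also have "ln (real (nth_prime j)) \<le> \<dots> \<longleftrightarrow> real (nth_prime j) \<le> real (nth_prime m) powr s"
    using nth_prime_gt_1[of m] nth_prime_gt_1[of j] by (intro ln_le_cancel_iff) auto
  finally show ?thesis .
qed

text \<open>The condition \<open>prime_pos m j \<le> s\<close> cuts out the primes up to
  \<open>p\<^sub>m powr s\<close>. Since \<open>s \<le> 1\<close>, all of these are among the first
  \<open>m\<close>, so the sum is a full Mertens sum.\<close>

lemma sum_prime_pos_eq_mertens_sum:
  assumes "1 \<le> m" "s \<le> 1"
  shows "(\<Sum>j | j \<in> {1..m} \<and> prime_pos m j \<le> s. prime_pos m j * prime_prob j) =
    mertens_sum (real (nth_prime m) powr s) / ln (real (nth_prime m))"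
proof -
  let ?x = "real (nth_prime m) powr s"
  have "?x \<le> real (nth_prime m) powr 1"
    using nth_prime_gt_1[of m] assms by (intro powr_mono) auto
  then have "?x \<le> real (nth_prime m)" using nth_prime_gt_1[of m] by simp
  then have "{p. prime p \<and> real p \<le> ?x} = {p \<in> {p. prime p \<and> p \<le> nth_prime m}. real p \<le> ?x}"
    by auto
  also have "\<dots> = {p \<in> nth_prime ` {1..m}. real p \<le> ?x}"
    using bij_betw_nth_prime[OF assms(1)] by (simp only: bij_betw_def)
  also have "\<dots> = nth_prime ` {j. j \<in> {1..m} \<and> prime_pos m j \<le> s}"
    unfolding prime_pos_le_iff by blast
  finally have *: "bij_betw nth_prime {j. j \<in> {1..m} \<and> prime_pos m j \<le> s} {p. prime p \<and> real p \<le> ?x}"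
    by (intro bij_betw_imageI inj_on_subset[OF inj_on_nth_prime]) auto
  have "mertens_sum ?x = (\<Sum>j | j \<in> {1..m} \<and> prime_pos m j \<le> s. ln (real (nth_prime j)) / (real (nth_prime j) + 1))"
    unfolding mertens_sum_def by (rule sum.reindex_bij_betw[OF *, symmetric])
  then show ?thesis
    by (simp add: prime_pos_def prime_prob_def sum_divide_distrib mult.commute)
qed

text \<open>Mertens' theorem at \<open>x = p\<^sub>m powr s\<close>: the factor \<open>s\<close>
  arises from \<open>ln x = s * ln p\<^sub>m\<close>, and \<open>s > 0\<close> makes
  \<open>x\<close> tend to infinity.\<close>

lemma prime_pos_sum_tendsto:
  assumes "0 < s" "s \<le> 1"
  shows "(\<lambda>m. \<Sum>j | j \<in> {1..m} \<and> prime_pos m j \<le> s. prime_pos m j * prime_prob j) \<longlonglongrightarrow> s"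
proof -
  have "filterlim (\<lambda>m. real (nth_prime m) powr s) at_top sequentially"
  proof (rule filterlim_compose[OF _ filterlim_nth_prime])
    show "filterlim (\<lambda>x::real. x powr s) at_top at_top"
      using assms by real_asymp
  qed
  then have "(\<lambda>m. mertens_sum (real (nth_prime m) powr s) / ln (real (nth_prime m) powr s)) \<longlonglongrightarrow> 1"
    by (rule filterlim_compose[OF mertens_sum_asymp])
  then have "(\<lambda>m. mertens_sum (real (nth_prime m) powr s) / ln (real (nth_prime m) powr s) * s) \<longlonglongrightarrow> 1 * s"
    by (intro tendsto_mult tendsto_const)
  moreover have "\<forall>\<^sub>F m in sequentially. mertens_sum (real (nth_prime m) powr s) / ln (real (nth_prime m) powr s) * s
      = (\<Sum>j | j \<in> {1..m} \<and> prime_pos m j \<le> s. prime_pos m j * prime_prob j)"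
    using eventually_ge_at_top[of 1]
  proof eventually_elim
    case (elim m)
    then show ?case
      using assms ln_nth_prime_pos[of m] nth_prime_gt_1[of m]
      by (subst sum_prime_pos_eq_mertens_sum) (auto simp: ln_powr field_simps)
  qed
  ultimately show ?thesis
    by (simp add: tendsto_cong)
qed

text \<open>The total mass by which the point masses are divided to become a probability
  distribution; also the mean of the sum of the independent variables.\<close>

definition prime_total :: "nat \<Rightarrow> real" where
  "prime_total m = (\<Sum>j=1..m. prime_pos m j * prime_prob j)"

lemma prime_total_tendsto: "prime_total \<longlonglongrightarrow> 1"
proof -
  have "{j. j \<in> {1..m} \<and> prime_pos m j \<le> 1} = {1..m}" for m
    using prime_pos_le_1 by blast
  then show ?thesis
    using prime_pos_sum_tendsto[of 1] by (simp add: prime_total_def[abs_def])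
qed

lemma prime_total_nonneg: "prime_total m \<ge> 0"
  unfolding prime_total_def
  by (intro sum_nonneg mult_nonneg_nonneg) (simp_all add: less_imp_le prime_pos_pos prime_prob_pos)

lemma prime_total_pos: "m \<ge> 1 \<Longrightarrow> prime_total m > 0"
  unfolding prime_total_def by (intro sum_pos) (auto simp: prime_pos_pos prime_prob_pos)

text \<open>These translate between finite weighted sums and distributions. They serve both the
  point masses on \<open>[0,1]\<close> and the law of \<open>zeta m\<close>.\<close>

lemma
  fixes w :: "'a \<Rightarrow> real" and X :: "'a \<Rightarrow> real"
  assumes "finite A" "\<And>a. a \<in> A \<Longrightarrow> 0 \<le> w a" "sum w A = 1"
  shows real_distribution_point_measure: "real_distribution (distr (point_measure A (\<lambda>a. ennreal (w a))) borel X)"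
    and cdf_point_measure: "cdf (distr (point_measure A (\<lambda>a. ennreal (w a))) borel X) x = (\<Sum>a | a \<in> A \<and> X a \<le> x. w a)"
    and integral_distr_point_measure: "\<And>f :: real \<Rightarrow> complex. f \<in> borel_measurable borel \<Longrightarrow>
      integral\<^sup>L (distr (point_measure A (\<lambda>a. ennreal (w a))) borel X) f = (\<Sum>a\<in>A. w a *\<^sub>R f (X a))"
proof -
  let ?P = "point_measure A (\<lambda>a. ennreal (w a))"
  have "prob_space ?P"
  proof
    show "emeasure ?P (space ?P) = 1"
      using assms by (simp add: space_point_measure emeasure_point_measure_finite sum_ennreal)
  qed
  then interpret prob_space ?P .
  show "real_distribution (distr ?P borel X)" by simp
  have "X -` {..x} \<inter> A = {a. a \<in> A \<and> X a \<le> x}" by auto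
  then show "cdf (distr ?P borel X) x = (\<Sum>a | a \<in> A \<and> X a \<le> x. w a)"
    using assms unfolding cdf_def
    by (subst measure_distr) (auto simp: space_point_measure measure_point_measure_finite_if)
  fix f :: "real \<Rightarrow> complex" assume "f \<in> borel_measurable borel"
  then show "integral\<^sup>L (distr ?P borel X) f = (\<Sum>a\<in>A. w a *\<^sub>R f (X a))"
    using assms by (subst integral_distr) (auto simp: lebesgue_integral_point_measure_finite)
qed

section \<open>Weak convergence to the uniform distribution\<close>

lemma cdf_uniform_unit: "cdf (uniform_measure lborel {0..1}) x = max 0 (min 1 x)"
proof -
  have "{0..1} \<inter> {..x} = {0..min 1 x}" by auto
  then show ?thesis
    unfolding cdf_def by (subst measure_uniform_measure) (auto simp: max_def)
qed

lemma real_distribution_uniform_unit: "real_distribution (uniform_measure lborel {0..1})"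
  unfolding real_distribution_def real_distribution_axioms_def
  by (auto intro!: prob_space_uniform_measure)

text \<open>Division by zero makes the value at \<open>v = 0\<close> equal to 0, while the limit
  there is \<open>\<i> * t\<close>. For \<open>t \<noteq> 0\<close> the function therefore jumps at
  this one point, which is a null set.\<close>

definition exp_quotient :: "real \<Rightarrow> real \<Rightarrow> complex" where
  "exp_quotient t v = (exp (\<i> * complex_of_real (t * v)) - 1) / complex_of_real v"

lemma integral_uniform_unit:
  fixes f :: "real \<Rightarrow> complex"
  assumes [measurable]: "f \<in> borel_measurable borel"
  shows "integral\<^sup>L (uniform_measure lborel {0..1}) f = (CLBINT v=0..1. f v)"
proof -
  have "uniform_measure lborel {0..1::real} = density lborel (\<lambda>x. ennreal (indicator {0..1} x))"
    unfolding uniform_measure_def by (intro density_cong) (auto simp: indicator_def)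
  then have "integral\<^sup>L (uniform_measure lborel {0..1}) f = (LINT v:{0..1}|lborel. f v)"
    by (simp add: integral_density set_lebesgue_integral_def)
  also have "\<dots> = (CLBINT v=0..1. f v)"
    using interval_integral_Icc[of 0 1 f] by (simp add: zero_ereal_def one_ereal_def)
  finally show ?thesis .
qed

lemma norm_iexp_minus_1_le: "norm (exp (\<i> * complex_of_real x) - 1) \<le> \<bar>x\<bar>"
  using iexp_approx1[of x 0] by simp

lemma norm_exp_quotient_le: "norm (exp_quotient t v) \<le> \<bar>t\<bar>"
proof (cases "v = 0")
  case False
  then show ?thesis
    using norm_iexp_minus_1_le[of "t * v"]
    by (simp add: exp_quotient_def norm_divide pos_divide_le_eq abs_mult)
qed (simp add: exp_quotient_def)

lemma borel_measurable_exp_quotient [measurable]: "exp_quotient t \<in> borel_measurable borel"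
  unfolding exp_quotient_def by measurable

lemma isCont_exp_quotient: "v \<noteq> 0 \<Longrightarrow> isCont (exp_quotient t) v"
  unfolding exp_quotient_def[abs_def] by (auto intro!: continuous_intros)

text \<open>Multiplying and dividing by \<open>prime_pos m j\<close> turns the sum into the integral
  of \<open>exp_quotient t\<close> against the point masses. Their weak convergence applies because
  this integrand is bounded by \<open>\<bar>t\<bar>\<close> and continuous off 0.\<close>

lemma exp_quotient_sum_tendsto:
  "(\<lambda>m. \<Sum>j=1..m. prime_prob j * (exp (\<i> * complex_of_real (t * prime_pos m j)) - 1))
    \<longlonglongrightarrow> (CLBINT v=0..1. exp_quotient t v)"
proof -
  define w where "w m j = prime_pos m j * prime_prob j / prime_total m" for m j
  \<comment> \<open>The index is shifted because \<open>prime_total 0 = 0\<close> admits no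
    normalisation.\<close>
  define \<mu> where "\<mu> m = distr (point_measure {1..Suc m} (\<lambda>j. ennreal (w (Suc m) j))) borel (prime_pos (Suc m))" for m
  have w: "0 \<le> w (Suc m) j" "(\<Sum>j=1..Suc m. w (Suc m) j) = 1" for m j
  proof -
    show "0 \<le> w (Suc m) j"
      unfolding w_def using prime_pos_pos prime_prob_pos prime_total_pos by (simp add: less_imp_le)
    have "(\<Sum>j=1..Suc m. w (Suc m) j) = prime_total (Suc m) / prime_total (Suc m)"
      unfolding w_def prime_total_def by (rule sum_divide_distrib[symmetric])
    then show "(\<Sum>j=1..Suc m. w (Suc m) j) = 1"
      using prime_total_pos[of "Suc m"] by simp
  qed
  have real_distr: "real_distribution (\<mu> m)" for m
    unfolding \<mu>_def using w by (intro real_distribution_point_measure) auto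
  have cdf: "cdf (\<mu> m) x = (\<Sum>j | j \<in> {1..Suc m} \<and> prime_pos (Suc m) j \<le> x. w (Suc m) j)" for m x
    unfolding \<mu>_def using w by (intro cdf_point_measure) auto
  \<comment> \<open>For \<open>x \<le> 0\<close> no mass is counted and for \<open>x > 1\<close> all
    of it; in between the limit comes from Mertens' theorem.\<close>
  have "(\<lambda>m. cdf (\<mu> m) x) \<longlonglongrightarrow> cdf (uniform_measure lborel {0..1}) x" for x
  proof -
    consider "x \<le> 0" | "0 < x" "x \<le> 1" | "1 < x" by linarith
    then show ?thesis
    proof cases
      case 1
      then have "{j. j \<in> {1..Suc m} \<and> prime_pos (Suc m) j \<le> x} = {}" for m
        using prime_pos_pos[of "Suc m"] by (auto simp: not_le intro: le_less_trans)
      then show ?thesis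
        using 1 unfolding cdf cdf_uniform_unit by (simp only:) simp
    next
      case 2
      have "(\<lambda>m. (\<Sum>j | j \<in> {1..m} \<and> prime_pos m j \<le> x. prime_pos m j * prime_prob j) / prime_total m) \<longlonglongrightarrow> x / 1"
        using 2 by (intro tendsto_divide prime_pos_sum_tendsto prime_total_tendsto) auto
      then have "(\<lambda>m. \<Sum>j | j \<in> {1..m} \<and> prime_pos m j \<le> x. w m j) \<longlonglongrightarrow> x"
        by (simp add: w_def sum_divide_distrib)
      then show ?thesis
        using 2 unfolding cdf cdf_uniform_unit by (intro LIMSEQ_Suc) auto
    next
      case 3
      then have "{j. j \<in> {1..Suc m} \<and> prime_pos (Suc m) j \<le> x} = {1..Suc m}" for m
        using prime_pos_le_1[of _ "Suc m"] by force
      then show ?thesis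
        using 3 w unfolding cdf cdf_uniform_unit by simp
    qed
  qed
  then have "weak_conv_m \<mu> (uniform_measure lborel {0..1})"
    by (simp add: weak_conv_m_def weak_conv_def)
  moreover have "emeasure (uniform_measure lborel {0..1}) {x. \<not> isCont (exp_quotient t) x} = 0"
  proof -
    have "{x. \<not> isCont (exp_quotient t) x} \<subseteq> {0}"
      using isCont_exp_quotient by auto
    then have "{x. \<not> isCont (exp_quotient t) x} = {} \<or> {x. \<not> isCont (exp_quotient t) x} = {0}"
      by blast
    then show ?thesis
      by (elim disjE) (simp_all add: emeasure_lborel_countable)
  qed
  ultimately have "(\<lambda>m. integral\<^sup>L (\<mu> m) (exp_quotient t)) \<longlonglongrightarrow> integral\<^sup>L (uniform_measure lborel {0..1}) (exp_quotient t)"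
    using real_distr real_distribution_uniform_unit norm_exp_quotient_le
    by (intro weak_conv_imp_bdd_ae_continuous_conv) auto
  then have "(\<lambda>m. \<Sum>j=1..Suc m. w (Suc m) j *\<^sub>R exp_quotient t (prime_pos (Suc m) j)) \<longlonglongrightarrow> (CLBINT v=0..1. exp_quotient t v)"
    unfolding \<mu>_def using w by (simp add: integral_distr_point_measure integral_uniform_unit)
  then have "(\<lambda>m. \<Sum>j=1..m. w m j *\<^sub>R exp_quotient t (prime_pos m j)) \<longlonglongrightarrow> (CLBINT v=0..1. exp_quotient t v)"
    by (rule LIMSEQ_imp_Suc)
  \<comment> \<open>Since \<open>prime_total\<close> tends to 1, the normalisation can be undone
    without changing the limit.\<close>
  then have "(\<lambda>m. prime_total m *\<^sub>R (\<Sum>j=1..m. w m j *\<^sub>R exp_quotient t (prime_pos m j))) \<longlonglongrightarrow> 1 *\<^sub>R (CLBINT v=0..1. exp_quotient t v)"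
    by (intro tendsto_scaleR prime_total_tendsto)
  moreover have "\<forall>\<^sub>F m in sequentially. prime_total m *\<^sub>R (\<Sum>j=1..m. w m j *\<^sub>R exp_quotient t (prime_pos m j)) =
      (\<Sum>j=1..m. prime_prob j * (exp (\<i> * complex_of_real (t * prime_pos m j)) - 1))"
    using eventually_ge_at_top[of 1]
  proof eventually_elim
    case (elim m)
    have "prime_pos m j \<noteq> 0" for j
      using prime_pos_pos[of m j] by simp
    then show ?case
      using prime_total_pos[OF elim] unfolding scaleR_sum_right
      by (intro sum.cong refl) (simp add: w_def exp_quotient_def scaleR_conv_of_real)
  qed
  ultimately show ?thesis
    by (simp add: tendsto_cong)
qed

section \<open>Limits of Bernoulli sums\<close>

lemma norm_one_plus_char_le_1:
  assumes "0 \<le> c" "c \<le> 1"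
  shows "norm (1 + of_real c * (exp (\<i> * complex_of_real x) - 1)) \<le> 1"
proof -
  have "1 + of_real c * (exp (\<i> * complex_of_real x) - 1) =
      of_real (1 - c) + of_real c * exp (\<i> * complex_of_real x)"
    by (simp add: algebra_simps)
  also have "norm \<dots> \<le> norm (complex_of_real (1 - c)) + norm (of_real c * exp (\<i> * complex_of_real x))"
    by (rule norm_triangle_ineq)
  also have "\<dots> = \<bar>1 - c\<bar> + \<bar>c\<bar>"
    by (simp only: norm_mult norm_of_real norm_exp_i_times mult_1_right)
  finally show ?thesis using assms by simp
qed

text \<open>This puts the exponential of the increment into the unit disc, where the factors
  \<open>1 + z\<close> also lie, as needed for comparing the two products.\<close>

lemma Re_char_minus_1_le_0:
  assumes "0 \<le> c"
  shows "Re (of_real c * (exp (\<i> * complex_of_real x) - 1)) \<le> 0"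
proof -
  have "Re (of_real c * (exp (\<i> * complex_of_real x) - 1)) = c * (cos x - 1)"
    by (simp add: Re_exp)
  also have "\<dots> \<le> 0"
    using assms by (intro mult_nonneg_nonpos) auto
  finally show ?thesis .
qed

lemma norm_exp_minus_linear_le:
  fixes z :: complex
  assumes "norm z \<le> 2"
  shows "norm (exp z - (1 + z)) \<le> exp 2 * (norm z)\<^sup>2"
proof -
  have "norm (exp z - (1 + z)) \<le> exp (norm z) * (norm z)\<^sup>2"
    using Taylor_exp_field[of z 1] by (simp add: power2_eq_square)
  also have "\<dots> \<le> exp 2 * (norm z)\<^sup>2"
    using assms by (intro mult_right_mono) auto
  finally show ?thesis .
qed

text \<open>Uniform smallness of the individual means, from \<open>ln p \<le> p + 1\<close>.\<close>

lemma prime_pos_mult_prob_le: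
  "prime_pos m j * prime_prob j \<le> 1 / ln (real (nth_prime m))"
proof -
  have "ln (real (nth_prime j)) \<le> real (nth_prime j) + 1"
    using ln_less_self[of "real (nth_prime j)"] nth_prime_gt_1[of j] by linarith
  then have "ln (real (nth_prime j)) / (real (nth_prime j) + 1) \<le> 1"
    by simp
  then have "ln (real (nth_prime j)) / (real (nth_prime j) + 1) / ln (real (nth_prime m)) \<le> 1 / ln (real (nth_prime m))"
    using ln_nth_prime_pos[of m] by (intro divide_right_mono) auto
  then show ?thesis
    by (simp add: prime_pos_def prime_prob_def mult.commute)
qed

text \<open>One plus this is the characteristic function of a variable equal to
  \<open>prime_pos m j\<close> with probability \<open>\<theta> * prime_prob j\<close> and to 0
  otherwise.\<close>

definition char_increment :: "real \<Rightarrow> real \<Rightarrow> nat \<Rightarrow> nat \<Rightarrow> complex" where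
  "char_increment \<theta> t m j =
    of_real (\<theta> * prime_prob j) * (exp (\<i> * complex_of_real (t * prime_pos m j)) - 1)"

text \<open>The increment is at most \<open>\<bar>t\<bar>\<close> times
  \<open>prime_pos m j * prime_prob j\<close>. In its square one copy of this product is bounded by
  \<open>1 / ln p\<^sub>m\<close>; the other is kept, so that summing over \<open>j\<close> gives
  \<open>prime_total m\<close>.\<close>

lemma char_increment_sq_le:
  assumes "0 \<le> \<theta>" "\<theta> \<le> 1"
  shows "(norm (char_increment \<theta> t m j))\<^sup>2 \<le> t\<^sup>2 / ln (real (nth_prime m)) * (prime_pos m j * prime_prob j)"
proof -
  have "norm (char_increment \<theta> t m j) \<le> \<theta> * prime_prob j * \<bar>t * prime_pos m j\<bar>"
    unfolding char_increment_def norm_mult norm_of_real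
    using assms prime_prob_pos[of j] norm_iexp_minus_1_le[of "t * prime_pos m j"]
    by (intro mult_mono) auto
  also have "\<dots> \<le> 1 * prime_prob j * \<bar>t * prime_pos m j\<bar>"
    using assms prime_prob_pos[of j] by (intro mult_right_mono) auto
  also have "\<dots> = \<bar>t\<bar> * (prime_pos m j * prime_prob j)"
    using prime_pos_pos[of m j] by (simp add: abs_mult)
  finally have "(norm (char_increment \<theta> t m j))\<^sup>2 \<le> (\<bar>t\<bar> * (prime_pos m j * prime_prob j))\<^sup>2"
    by (intro power_mono) auto
  also have "\<dots> = t\<^sup>2 * ((prime_pos m j * prime_prob j) * (prime_pos m j * prime_prob j))"
    by (simp add: power2_eq_square)
  also have "\<dots> \<le> t\<^sup>2 * (1 / ln (real (nth_prime m)) * (prime_pos m j * prime_prob j))"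
    using prime_pos_pos[of m j] prime_prob_pos[of j]
    by (intro mult_left_mono mult_right_mono prime_pos_mult_prob_le) auto
  finally show ?thesis by simp
qed

text \<open>Each factor \<open>1 + z\<close> is replaced by \<open>exp z\<close> at a cost quadratic
  in \<open>z\<close>. The total cost is of order \<open>prime_total m / ln p\<^sub>m\<close> and
  vanishes, and no complex logarithm is taken.\<close>

lemma prod_char_increment_tendsto:
  assumes "0 \<le> \<theta>" "\<theta> \<le> 1"
  shows "(\<lambda>m. \<Prod>j=1..m. 1 + char_increment \<theta> t m j) \<longlonglongrightarrow>
    exp (of_real \<theta> * (CLBINT v=0..1. exp_quotient t v))"
proof -
  let ?z = "char_increment \<theta> t"
  have c: "0 \<le> \<theta> * prime_prob j" "\<theta> * prime_prob j \<le> 1" for j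
    using assms prime_prob_pos[of j] prime_prob_le_1[of j] by (auto intro: mult_le_one)
  have z2: "norm (?z m j) \<le> 2" for m j
  proof -
    have "norm (?z m j) \<le> 1 * (norm (exp (\<i> * complex_of_real (t * prime_pos m j))) + norm (1 :: complex))"
      unfolding char_increment_def norm_mult norm_of_real
      using c[of j] by (intro mult_mono norm_triangle_ineq4) auto
    then show ?thesis
      by (simp only: norm_exp_i_times norm_one) simp
  qed
  have bound: "norm ((\<Prod>j=1..m. 1 + ?z m j) - exp (\<Sum>j=1..m. ?z m j)) \<le>
      exp 2 * (t\<^sup>2 / ln (real (nth_prime m)) * prime_total m)" for m
  proof -
    \<comment> \<open>For factors in the closed unit disc, the distance of two products is at most
      the sum of the distances of the factors.\<close>
    have "norm ((\<Prod>j=1..m. 1 + ?z m j) - (\<Prod>j=1..m. exp (?z m j))) \<le> (\<Sum>j=1..m. norm ((1 + ?z m j) - exp (?z m j)))"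
    proof (rule norm_prod_diff)
      show "norm (1 + ?z m j) \<le> 1" for j
        unfolding char_increment_def by (rule norm_one_plus_char_le_1[OF c])
      show "norm (exp (?z m j)) \<le> 1" for j
        unfolding norm_exp_eq_Re using Re_char_minus_1_le_0[OF c(1)]
        by (simp add: char_increment_def del: of_real_mult)
    qed
    also have "\<dots> \<le> (\<Sum>j=1..m. exp 2 * (t\<^sup>2 / ln (real (nth_prime m)) * (prime_pos m j * prime_prob j)))"
    proof (rule sum_mono)
      fix j
      have "norm ((1 + ?z m j) - exp (?z m j)) \<le> exp 2 * (norm (?z m j))\<^sup>2"
        using norm_exp_minus_linear_le[OF z2] by (simp add: norm_minus_commute)
      also have "\<dots> \<le> exp 2 * (t\<^sup>2 / ln (real (nth_prime m)) * (prime_pos m j * prime_prob j))"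
        using char_increment_sq_le[OF assms] by (intro mult_left_mono) auto
      finally show "norm ((1 + ?z m j) - exp (?z m j)) \<le> \<dots>" .
    qed
    also have "\<dots> = exp 2 * (t\<^sup>2 / ln (real (nth_prime m)) * prime_total m)"
      by (simp add: prime_total_def sum_distrib_left)
    finally show ?thesis by (simp add: exp_sum)
  qed
  have "filterlim (\<lambda>m. ln (real (nth_prime m))) at_top sequentially"
    by (rule filterlim_compose[OF ln_at_top filterlim_nth_prime])
  then have "(\<lambda>m. t\<^sup>2 / ln (real (nth_prime m))) \<longlonglongrightarrow> 0"
    by (intro tendsto_divide_0[OF tendsto_const] filterlim_at_top_imp_at_infinity)
  then have "(\<lambda>m. exp 2 * (t\<^sup>2 / ln (real (nth_prime m)) * prime_total m)) \<longlonglongrightarrow> exp 2 * (0 * 1)"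
    by (intro tendsto_mult tendsto_const prime_total_tendsto)
  then have "(\<lambda>m. exp 2 * (t\<^sup>2 / ln (real (nth_prime m)) * prime_total m)) \<longlonglongrightarrow> 0"
    by simp
  then have "(\<lambda>m. (\<Prod>j=1..m. 1 + ?z m j) - exp (\<Sum>j=1..m. ?z m j)) \<longlonglongrightarrow> 0"
    by (rule Lim_null_comparison[rotated]) (use bound in auto)
  moreover have "(\<lambda>m. exp (\<Sum>j=1..m. ?z m j)) \<longlonglongrightarrow> exp (of_real \<theta> * (CLBINT v=0..1. exp_quotient t v))"
  proof (rule tendsto_exp)
    have "(\<lambda>m. of_real \<theta> * (\<Sum>j=1..m. prime_prob j * (exp (\<i> * complex_of_real (t * prime_pos m j)) - 1)))
       \<longlonglongrightarrow> of_real \<theta> * (CLBINT v=0..1. exp_quotient t v)"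
      by (intro tendsto_mult tendsto_const exp_quotient_sum_tendsto)
    then show "(\<lambda>m. \<Sum>j=1..m. ?z m j) \<longlonglongrightarrow> of_real \<theta> * (CLBINT v=0..1. exp_quotient t v)"
      by (simp only: sum_distrib_left char_increment_def of_real_mult mult.assoc)
  qed
  ultimately show ?thesis
    using tendsto_add by fastforce
qed

section \<open>Bernoulli sums with scaled probabilities and their weak limits\<close>

definition bernoulli_sum :: "real \<Rightarrow> nat \<Rightarrow> real measure" where
  "bernoulli_sum \<theta> m = distr (measure_pmf (Pi_pmf {1..m} False (\<lambda>j. bernoulli_pmf (\<theta> * prime_prob j)))) borel
     (\<lambda>b. \<Sum>j=1..m. if b j then prime_pos m j else 0)"

lemma real_distribution_bernoulli_sum: "real_distribution (bernoulli_sum \<theta> m)"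
  unfolding bernoulli_sum_def
  by (intro prob_space.real_distribution_distr prob_space_measure_pmf) simp

lemma
  fixes f :: "bool \<Rightarrow> 'b :: {banach, second_countable_topology}"
  assumes "0 \<le> \<theta>" "\<theta> \<le> 1" "j \<in> {1..m}"
  shows integral_bernoulli_component:
    "(LINT b|measure_pmf (Pi_pmf {1..m} False (\<lambda>j. bernoulli_pmf (\<theta> * prime_prob j))). f (b j)) =
      (\<theta> * prime_prob j) *\<^sub>R f True + (1 - \<theta> * prime_prob j) *\<^sub>R f False"
    and integrable_bernoulli_component:
    "integrable (measure_pmf (Pi_pmf {1..m} False (\<lambda>j. bernoulli_pmf (\<theta> * prime_prob j)))) (\<lambda>b. f (b j))"
proof -
  have c: "0 \<le> \<theta> * prime_prob j" "\<theta> * prime_prob j \<le> 1"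
    using assms prime_prob_pos[of j] prime_prob_le_1[of j] by (auto intro: mult_le_one)
  let ?P = "Pi_pmf {1..m} False (\<lambda>j. bernoulli_pmf (\<theta> * prime_prob j))"
  have eq: "map_pmf (\<lambda>b. b j) ?P = bernoulli_pmf (\<theta> * prime_prob j)"
    using assms by (simp add: Pi_pmf_component)
  have "(LINT b|?P. f (b j)) = (LINT x|map_pmf (\<lambda>b. b j) ?P. f x)"
    by (simp add: integral_map_pmf)
  also have "\<dots> = (\<Sum>x\<in>UNIV. pmf (bernoulli_pmf (\<theta> * prime_prob j)) x *\<^sub>R f x)"
    unfolding eq by (intro integral_measure_pmf) auto
  finally show "(LINT b|?P. f (b j)) = (\<theta> * prime_prob j) *\<^sub>R f True + (1 - \<theta> * prime_prob j) *\<^sub>R f False"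
    using c by (simp add: UNIV_bool)
  have "integrable (map_pmf (\<lambda>b. b j) ?P) f"
    unfolding eq by (intro integrable_measure_pmf_finite) auto
  then show "integrable ?P (\<lambda>b. f (b j))"
    by simp
qed

text \<open>The coordinates of \<open>Pi_pmf\<close> are independent, so the characteristic function
  factors over \<open>j\<close>.\<close>

lemma char_bernoulli_sum:
  assumes "0 \<le> \<theta>" "\<theta> \<le> 1"
  shows "char (bernoulli_sum \<theta> m) t = (\<Prod>j=1..m. 1 + char_increment \<theta> t m j)"
proof -
  let ?P = "measure_pmf (Pi_pmf {1..m} False (\<lambda>j. bernoulli_pmf (\<theta> * prime_prob j)))"
  have "prob_space.indep_vars ?P (\<lambda>_. count_space UNIV) (\<lambda>j b. b j) {1..m}"
    by (intro indep_vars_Pi_pmf) simp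
  then have "prob_space.indep_vars ?P (\<lambda>_. borel) (\<lambda>j b. if b j then prime_pos m j else 0) {1..m}"
    by (rule prob_space.indep_vars_compose2[OF prob_space_measure_pmf, where Y="\<lambda>j x. if x then prime_pos m j else 0"]) auto
  then have "char (bernoulli_sum \<theta> m) t =
      (\<Prod>j=1..m. char (distr ?P borel (\<lambda>b. if b j then prime_pos m j else 0)) t)"
    unfolding bernoulli_sum_def by (rule prob_space.char_distr_sum[OF prob_space_measure_pmf])
  also have "\<dots> = (\<Prod>j=1..m. 1 + char_increment \<theta> t m j)"
  proof (rule prod.cong)
    fix j assume j: "j \<in> {1..m}"
    have "char (distr ?P borel (\<lambda>b. if b j then prime_pos m j else 0)) t =
        (LINT b|?P. exp (\<i> * complex_of_real (t * (if b j then prime_pos m j else 0))))"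
      unfolding char_def by (subst integral_distr) auto
    also have "\<dots> = (\<theta> * prime_prob j) *\<^sub>R exp (\<i> * complex_of_real (t * prime_pos m j)) + (1 - \<theta> * prime_prob j) *\<^sub>R 1"
      using integral_bernoulli_component[OF assms j, of "\<lambda>b. exp (\<i> * complex_of_real (t * (if b then prime_pos m j else 0)))"]
      by simp
    also have "\<dots> = 1 + char_increment \<theta> t m j"
      by (simp add: char_increment_def scaleR_conv_of_real algebra_simps)
    finally show "char (distr ?P borel (\<lambda>b. if b j then prime_pos m j else 0)) t = 1 + char_increment \<theta> t m j" .
  qed simp
  finally show ?thesis .
qed

text \<open>The sums are nonnegative with mean \<open>\<theta> * prime_total m\<close>, which is
  bounded because \<open>prime_total\<close> converges; Markov's inequality controls the upper tail
  uniformly in \<open>m\<close>.\<close>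

lemma tight_bernoulli_sum:
  assumes "0 \<le> \<theta>" "\<theta> \<le> 1"
  shows "tight (bernoulli_sum \<theta>)"
  unfolding tight_def
proof (intro conjI allI impI real_distribution_bernoulli_sum)
  fix \<epsilon> :: real assume \<epsilon>: "0 < \<epsilon>"
  obtain B where B: "B > 0" "\<And>m. norm (prime_total m) \<le> B"
    using convergent_imp_Bseq[OF convergentI[OF prime_total_tendsto]] unfolding Bseq_def by blast
  \<comment> \<open>With this choice Markov's bound \<open>B / b\<close> is
    \<open>\<epsilon> / 2\<close>, strictly below \<open>\<epsilon>\<close>.\<close>
  define b where "b = 2 * B / \<epsilon>"
  have b: "b > 0" using B \<epsilon> by (simp add: b_def)
  \<comment> \<open>The interval is open on the left, so its end must be negative to include the
    value 0.\<close>
  have "measure (bernoulli_sum \<theta> m) {-1<..b} > 1 - \<epsilon>" for m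
  proof -
    let ?P = "measure_pmf (Pi_pmf {1..m} False (\<lambda>j. bernoulli_pmf (\<theta> * prime_prob j)))"
    define S where "S = (\<lambda>c :: nat \<Rightarrow> bool. \<Sum>j=1..m. if c j then prime_pos m j else 0)"
    have S_nonneg: "S c \<ge> 0" for c
      unfolding S_def using prime_pos_pos by (intro sum_nonneg) (auto intro: less_imp_le)
    have int_j: "integrable ?P (\<lambda>c. if c j then prime_pos m j else 0)" if "j \<in> {1..m}" for j
      using integrable_bernoulli_component[OF assms that, of "\<lambda>x. if x then prime_pos m j else 0"] .
    have int: "integrable ?P S"
      unfolding S_def by (intro Bochner_Integration.integrable_sum int_j)
    have "integral\<^sup>L ?P S = (\<Sum>j=1..m. integral\<^sup>L ?P (\<lambda>c. if c j then prime_pos m j else 0))"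
      unfolding S_def by (intro Bochner_Integration.integral_sum int_j)
    also have "\<dots> = (\<Sum>j=1..m. \<theta> * prime_prob j * prime_pos m j)"
    proof (rule sum.cong)
      fix j assume "j \<in> {1..m}"
      from integral_bernoulli_component[OF assms this, of "\<lambda>x. if x then prime_pos m j else 0"]
      show "integral\<^sup>L ?P (\<lambda>c. if c j then prime_pos m j else 0) = \<theta> * prime_prob j * prime_pos m j"
        by simp
    qed simp
    also have "\<dots> = \<theta> * prime_total m"
      by (simp add: prime_total_def sum_distrib_left mult_ac)
    also have "\<dots> \<le> 1 * B"
      using assms B(1) B(2)[of m] by (intro mult_mono') (auto simp: prime_total_nonneg)
    finally have E: "integral\<^sup>L ?P S \<le> B" by simp
    have "measure ?P {c\<in>space ?P. b \<le> S c} \<le> integral\<^sup>L ?P S / b"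
      by (rule integral_Markov_inequality_measure[OF int, of "{}"]) (use S_nonneg b in auto)
    also have "\<dots> \<le> B / b"
      using E b by (intro divide_right_mono) auto
    also have "\<dots> < \<epsilon>"
      using B \<epsilon> by (simp add: b_def field_simps)
    finally have *: "measure ?P {c. b \<le> S c} < \<epsilon>" by simp
    have "1 - measure ?P {c. b \<le> S c} = measure ?P (- {c. b \<le> S c})"
      by (subst measure_pmf.prob_compl[symmetric]) (auto simp: Compl_eq_Diff_UNIV)
    also have "\<dots> \<le> measure ?P (S -` {-1<..b})"
    proof (intro measure_pmf.finite_measure_mono subsetI)
      fix c assume "c \<in> - {c. b \<le> S c}"
      then show "c \<in> S -` {-1<..b}"
        using S_nonneg[of c] by simp
    qed simp
    also have "\<dots> = measure (bernoulli_sum \<theta> m) {-1<..b}"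
      unfolding bernoulli_sum_def S_def by (subst measure_distr) auto
    finally show ?thesis using * by simp
  qed
  then show "\<exists>a b. a < b \<and> (\<forall>m. measure (bernoulli_sum \<theta> m) {a<..b} > 1 - \<epsilon>)"
    using b by (intro exI[of _ "-1"] exI[of _ b]) auto
qed

text \<open>Tightness supplies a weakly convergent subsequence. Its limit has the required
  characteristic function, since the characteristic functions converge pointwise along the whole
  sequence.\<close>

lemma exists_limit_distribution:
  assumes "0 \<le> \<theta>" "\<theta> \<le> 1"
  shows "\<exists>M. real_distribution M \<and> (\<forall>t. char M t = exp (of_real \<theta> * (CLBINT v=0..1. exp_quotient t v)))"
proof -
  obtain r M where r: "strict_mono (r :: nat \<Rightarrow> nat)" and M: "real_distribution M"
    and conv: "weak_conv_m (bernoulli_sum \<theta> \<circ> id \<circ> r) M"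
    using tight_imp_convergent_subsubsequence[OF tight_bernoulli_sum[OF assms] strict_mono_id] by blast
  have "char M t = exp (of_real \<theta> * (CLBINT v=0..1. exp_quotient t v))" for t
  proof (rule LIMSEQ_unique)
    show "(\<lambda>n. char ((bernoulli_sum \<theta> \<circ> id \<circ> r) n) t) \<longlonglongrightarrow> char M t"
      by (rule levy_continuity1[OF _ M conv]) (simp add: real_distribution_bernoulli_sum)
    show "(\<lambda>n. char ((bernoulli_sum \<theta> \<circ> id \<circ> r) n) t) \<longlonglongrightarrow> exp (of_real \<theta> * (CLBINT v=0..1. exp_quotient t v))"
      using LIMSEQ_subseq_LIMSEQ[OF prod_char_increment_tendsto[OF assms] r, of t]
      by (simp add: char_bernoulli_sum[OF assms] o_def)
  qed
  with M show ?thesis by blast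
qed

section \<open>Convolutions and infinite divisibility\<close>

lemma real_distribution_convolution:
  assumes "real_distribution M" "real_distribution N"
  shows "real_distribution (convolution M N)"
proof -
  interpret M: real_distribution M by fact
  interpret N: real_distribution N by fact
  interpret pair_prob_space M N ..
  show ?thesis
    unfolding convolution_def by (intro real_distribution_distr) measurable
qed

lemma char_convolution:
  assumes "real_distribution M" "real_distribution N"
  shows "char (convolution M N) t = char M t * char N t"
proof -
  interpret M: real_distribution M by fact
  interpret N: real_distribution N by fact
  interpret pair_prob_space M N ..
  have int: "integrable (M \<Otimes>\<^sub>M N) (\<lambda>(x, y). exp (\<i> * complex_of_real (t * (x + y))))"
    by (rule P.integrable_const_bound[where B=1]) (auto simp: split_beta norm_exp_i_times simp del: of_real_mult of_real_add)
  have "char (convolution M N) t = (LINT z|(M \<Otimes>\<^sub>M N). (\<lambda>(x, y). exp (\<i> * complex_of_real (t * (x + y)))) z)"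
    unfolding char_def convolution_def by (subst integral_distr) (simp_all add: case_prod_unfold)
  also have "\<dots> = (LINT x|M. LINT y|N. exp (\<i> * complex_of_real (t * (x + y))))"
    using integral_fst[OF int] by simp
  also have "\<dots> = (LINT x|M. exp (\<i> * complex_of_real (t * x)) * char N t)"
    unfolding char_def by (simp add: distrib_left exp_add)
  also have "\<dots> = char M t * char N t"
    unfolding char_def by simp
  finally show ?thesis .
qed

text \<open>Both claims go through one induction, since multiplicativity of \<open>char\<close>
  requires the smaller power to be a distribution.\<close>

lemma convolution_power:
  assumes "real_distribution N"
  shows "real_distribution (convolution_power N k) \<and> char (convolution_power N k) t = char N t ^ k"
proof (induction k)
  case 0
  show ?case
    by (auto simp: real_distribution_def real_distribution_axioms_def prob_space_return char_def integral_return)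
qed (simp add: assms real_distribution_convolution char_convolution)

text \<open>The limit for \<open>\<theta> = 1 / k\<close> is a \<open>k\<close>-th convolution root:
  the \<open>k\<close>-th power of its characteristic function is that of \<open>M\<close>, and
  Levy's uniqueness theorem identifies the distributions.\<close>

lemma exp_quotient_infinitely_divisible:
  assumes M: "real_distribution M"
    and char_M: "\<And>t. char M t = exp (CLBINT v=0..1. exp_quotient t v)"
  shows "infinitely_divisible M"
  unfolding infinitely_divisible_def
proof (intro conjI M allI impI)
  fix k :: nat assume k: "1 \<le> k"
  obtain N where N: "real_distribution N"
    and char_N: "\<And>t. char N t = exp (of_real (1 / real k) * (CLBINT v=0..1. exp_quotient t v))"
    using exists_limit_distribution[of "1 / real k"] k by auto
  have "char (convolution_power N k) t = char M t" for t
    using convolution_power[OF N, of k t] k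
    by (simp add: char_M char_N exp_of_nat_mult[symmetric])
  then have "M = convolution_power N k"
    using convolution_power[OF N] M by (intro Levy_uniqueness) (auto simp: fun_eq_iff)
  with N show "\<exists>N. real_distribution N \<and> M = convolution_power N k" by blast
qed

section \<open>The distribution of zeta\<close>

text \<open>Subsets of \<open>{1..m}\<close> index the elements of \<open>Omega_set m\<close>; a sum
  over all subsets can then be recognised as an expanded product.\<close>

definition squarefree_prod :: "nat set \<Rightarrow> nat" where
  "squarefree_prod S = (\<Prod>j\<in>S. nth_prime j)"

lemma nu_squarefree_prod:
  assumes "S \<subseteq> {1..m}" "j \<ge> 1"
  shows "nu j (squarefree_prod S) = of_bool (j \<in> S)"
proof -
  have inj: "inj_on nth_prime S"
    using assms by (intro inj_on_subset[OF inj_on_nth_prime]) auto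
  have "squarefree_prod S = (\<Prod>p\<in>nth_prime ` S. p ^ 1)"
    unfolding squarefree_prod_def by (subst prod.reindex[OF inj]) simp
  also have "multiplicity (nth_prime j) \<dots> = (if nth_prime j \<in> nth_prime ` S then 1 else 0)"
    using finite_subset[OF assms(1)] prime_nth_prime
    by (intro multiplicity_prod_prime_powers) auto
  also have "nth_prime j \<in> nth_prime ` S \<longleftrightarrow> j \<in> S"
    using assms by (intro inj_on_image_mem_iff[OF inj_on_nth_prime]) auto
  finally show ?thesis by (simp add: nu_def)
qed

lemma Omega_set_eq: "Omega_set m = squarefree_prod ` Pow {1..m}"
proof (intro equalityI subsetI)
  fix n assume "n \<in> Omega_set m"
  then obtain \<nu> where \<nu>: "\<forall>j\<in>{1..m}. \<nu> j \<in> {0, 1 :: nat}" "n = (\<Prod>j=1..m. nth_prime j ^ \<nu> j)"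
    unfolding Omega_set_def by blast
  have "n = (\<Prod>j=1..m. if \<nu> j = 1 then nth_prime j else 1)"
    unfolding \<nu>(2) using \<nu>(1) by (intro prod.cong) auto
  also have "\<dots> = squarefree_prod {j\<in>{1..m}. \<nu> j = 1}"
    unfolding squarefree_prod_def by (rule prod.inter_filter[symmetric]) simp
  finally show "n \<in> squarefree_prod ` Pow {1..m}" by blast
next
  fix n assume "n \<in> squarefree_prod ` Pow {1..m}"
  then obtain S where S: "S \<subseteq> {1..m}" "n = squarefree_prod S" by blast
  have "n = (\<Prod>j\<in>{j\<in>{1..m}. j \<in> S}. nth_prime j)"
    unfolding S(2) squarefree_prod_def using S(1) by (intro prod.cong) auto
  also have "\<dots> = (\<Prod>j=1..m. if j \<in> S then nth_prime j else 1)"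
    by (rule prod.inter_filter) simp
  also have "\<dots> = (\<Prod>j=1..m. nth_prime j ^ of_bool (j \<in> S))"
    by (intro prod.cong) auto
  finally show "n \<in> Omega_set m"
    unfolding Omega_set_def by (intro CollectI exI[of _ "\<lambda>j. of_bool (j \<in> S)"]) auto
qed

text \<open>The exponents \<open>nu j\<close> recover the subset, by unique factorization.\<close>

lemma inj_on_squarefree_prod: "inj_on squarefree_prod (Pow {1..m})"
proof (rule inj_onI)
  fix S T assume *: "S \<in> Pow {1..m}" "T \<in> Pow {1..m}" "squarefree_prod S = squarefree_prod T"
  have "j \<in> S \<longleftrightarrow> j \<in> T" if "j \<in> {1..m}" for j
  proof -
    have "(of_bool (j \<in> S) :: nat) = of_bool (j \<in> T)"
      using * that nu_squarefree_prod[of S m j] nu_squarefree_prod[of T m j] by simp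
    then show ?thesis by (simp add: of_bool_eq_iff)
  qed
  with * show "S = T" by blast
qed

lemma sum_Omega_set: "(\<Sum>n\<in>Omega_set m. f n) = (\<Sum>S\<in>Pow {1..m}. f (squarefree_prod S))"
  unfolding Omega_set_eq by (rule sum.reindex_cong[OF inj_on_squarefree_prod]) auto

lemma zeta_squarefree_prod:
  assumes "S \<subseteq> {1..m}"
  shows "zeta m (squarefree_prod S) = (\<Sum>j\<in>S. prime_pos m j)"
proof -
  have "zeta m (squarefree_prod S) = (\<Sum>j=1..m. if j \<in> S then prime_pos m j else 0)"
    unfolding zeta_def sum_distrib_left
    using nu_squarefree_prod[OF assms] by (intro sum.cong) (auto simp: prime_pos_def)
  also have "\<dots> = (\<Sum>j\<in>{j\<in>{1..m}. j \<in> S}. prime_pos m j)"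
    by (rule sum.inter_filter[symmetric]) simp
  also have "{j\<in>{1..m}. j \<in> S} = S" using assms by auto
  finally show ?thesis .
qed

text \<open>Expanding the product gives one term per subset \<open>S\<close>, the reciprocal of
  \<open>squarefree_prod S\<close>.\<close>

lemma Z_norm_eq: "Z_norm m = (\<Prod>j=1..m. 1 / real (nth_prime j) + 1)"
  unfolding Z_norm_def sum_Omega_set
  by (subst prod_add) (simp_all add: squarefree_prod_def prod_dividef)

lemma Z_norm_pos: "Z_norm m > 0"
  unfolding Z_norm_eq by (intro prod_pos) (simp add: add_nonneg_pos)

lemma finite_Omega_set: "finite (Omega_set m)"
  unfolding Omega_set_eq by simp

lemma Pi_weight_nonneg: "0 \<le> 1 / Z_norm m * (1 / real n)"
  using Z_norm_pos[of m] by simp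

lemma sum_Pi_weight: "(\<Sum>n\<in>Omega_set m. 1 / Z_norm m * (1 / real n)) = 1"
  using Z_norm_pos[of m] by (simp only: sum_distrib_left[symmetric] Z_norm_def[symmetric]) simp

lemma real_distribution_zeta: "real_distribution (distr (Pi_distr m) borel (zeta m))"
  unfolding Pi_distr_def
  by (intro real_distribution_point_measure finite_Omega_set Pi_weight_nonneg sum_Pi_weight)

text \<open>Independence of the exponents appears here as an algebraic factorization: both the
  weight \<open>1 / n\<close> and the exponential of \<open>zeta m n\<close> are products over the
  selected indices.\<close>

lemma char_zeta:
  "char (distr (Pi_distr m) borel (zeta m)) t = (\<Prod>j=1..m. 1 + char_increment 1 t m j)"
proof -
  let ?e = "\<lambda>j. exp (\<i> * complex_of_real (t * prime_pos m j))"
  let ?p = "\<lambda>j. complex_of_real (real (nth_prime j))"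
  have "char (distr (Pi_distr m) borel (zeta m)) t =
      (\<Sum>n\<in>Omega_set m. (1 / Z_norm m * (1 / real n)) *\<^sub>R exp (\<i> * complex_of_real (t * zeta m n)))"
    unfolding char_def Pi_distr_def
    by (intro integral_distr_point_measure finite_Omega_set Pi_weight_nonneg sum_Pi_weight) measurable
  also have "\<dots> = (\<Sum>S\<in>Pow {1..m}. of_real (1 / Z_norm m) * (\<Prod>j\<in>S. ?e j / ?p j))"
    unfolding sum_Omega_set
  proof (rule sum.cong)
    fix S assume S: "S \<in> Pow {1..m}"
    then have "exp (\<i> * complex_of_real (t * zeta m (squarefree_prod S))) = (\<Prod>j\<in>S. ?e j)"
      using finite_subset[of S "{1..m}"] by (simp add: zeta_squarefree_prod exp_sum sum_distrib_left)
    then show "(1 / Z_norm m * (1 / real (squarefree_prod S))) *\<^sub>R exp (\<i> * complex_of_real (t * zeta m (squarefree_prod S))) =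
        of_real (1 / Z_norm m) * (\<Prod>j\<in>S. ?e j / ?p j)"
      by (simp add: scaleR_conv_of_real squarefree_prod_def prod_dividef del: of_real_mult)
        (simp add: of_real_mult)
  qed simp
  \<comment> \<open>The sum over subsets is folded back into a product; the summand 1 stands for an
    index left out.\<close>
  also have "\<dots> = of_real (1 / Z_norm m) * (\<Prod>j=1..m. ?e j / ?p j + 1)"
    by (subst prod_add) (simp_all add: sum_distrib_left)
  also have "\<dots> = (\<Prod>j=1..m. (?e j / ?p j + 1) / (1 / ?p j + 1))"
    unfolding Z_norm_eq by (simp add: prod_dividef)
  also have "\<dots> = (\<Prod>j=1..m. 1 + char_increment 1 t m j)"
  proof (rule prod.cong)
    fix j
    have p: "?p j \<noteq> 0" "?p j + 1 \<noteq> 0"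
      using nth_prime_gt_1[of j] by (simp_all add: complex_eq_iff)
    have "(?e j / ?p j + 1) / (1 / ?p j + 1) = ((?e j + ?p j) / ?p j) / ((?p j + 1) / ?p j)"
      using p(1) by (simp add: add_divide_distrib add.commute)
    also have "\<dots> = (?e j + ?p j) / (?p j + 1)"
      using p(1) by simp
    also have "\<dots> = ((?p j + 1) + (?e j - 1)) / (?p j + 1)"
      by simp
    also have "\<dots> = 1 + 1 / (?p j + 1) * (?e j - 1)"
      using p(2) by (subst add_divide_distrib) simp
    also have "\<dots> = 1 + char_increment 1 t m j"
      by (simp add: char_increment_def prime_prob_def del: of_real_mult)
    finally show "(?e j / ?p j + 1) / (1 / ?p j + 1) = 1 + char_increment 1 t m j" .
  qed simp
  finally show ?thesis .
qed

theorem theorem1p1: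
  shows "\<exists>M :: real measure.
    real_distribution M \<and> infinitely_divisible M \<and>
    (\<forall>t :: real. char M t =
      exp (CLBINT v=0..1. (exp (\<i> * complex_of_real (t * v)) - 1) / complex_of_real v)) \<and>
    weak_conv_m (\<lambda>m. distr (Pi_distr m) borel (zeta m)) M"
proof -
  obtain M where M: "real_distribution M"
    and char_M: "\<And>t. char M t = exp (CLBINT v=0..1. exp_quotient t v)"
    using exists_limit_distribution[of 1] by auto
  \<comment> \<open>Case \<open>\<theta> = 1\<close> of the product limit; Levy's continuity theorem
    then turns pointwise convergence into weak convergence.\<close>
  have "(\<lambda>m. char (distr (Pi_distr m) borel (zeta m)) t) \<longlonglongrightarrow> char M t" for t
    using prod_char_increment_tendsto[of 1 t] by (simp add: char_zeta char_M)
  then have "weak_conv_m (\<lambda>m. distr (Pi_distr m) borel (zeta m)) M"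
    by (intro levy_continuity real_distribution_zeta M)
  with M char_M exp_quotient_infinitely_divisible[OF M char_M] show ?thesis
    unfolding exp_quotient_def by blast
qed

end
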